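(* Let $a\ge1$ and $n\ge a+2$, and let $K(1^a21^{n-a-2})$ be the generalized bull, i.e. the graph obtained from the path $v_1v_2\cdots v_n$ by adding the edge $v_av_{a+2}$. Then \[ X_{K(1^a21^{n-a-2})}=\sum_{\substack{I\vDash n,\ i_{-1}\ge3\\ \Theta_I^+(a)\le1}}\frac{i_{-1}-2}{i_{-1}-1}\,w_Ie_I+\sum_{\substack{I\vDash n\\ \Theta_I^+(a)\ge2}}2\,w_Ie_I+\sum_{\substack{J\vDash n-1\\ \Theta_J^+(a)\ge2}}w_J\,e_{J1}. \]
   Context: A composition $I=i_1\cdots i_s\vDash n$ is a sequence of positive integers with sum $n$; $i_{-1}=i_s$; $J1$ denotes the composition $J$ followed by a part $1$; $e_I=e_{i_1}\cdots e_{i_s}$ (elementary symmetric functions); $w_I=i_1\prod_{j\ge2}(i_j-1)$. For $0\le c\le|I|$, $\sigma_I^+(c)=\min\{i_1+\dots+i_k:0\le k\le s,\ i_1+\dots+i_k\ge c\}$ and $\Theta_I^+(c)=\sigma_I^+(c)-c$. The chromatic symmetric function is $X_G=\sum_\kappa\prod_vx_{\kappa(v)}$ over proper colorings $\kappa:V(G)\to\{1,2,\dots\}$. *)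

theory Defs
  imports Complex_Main "HOL-Library.Multiset" "HOL-Library.FuncSet"
begin

section \<open>Formal power series in the variables \<open>x\<^sub>0, x\<^sub>1, x\<^sub>2, \<dots>\<close>\<close>

text \<open>
  A monomial is encoded as the finite multiset of the indices of its variables, so that
  \<open>{#1, 1, 3#}\<close> is the monomial \<open>x\<^sub>1\<^sup>2 x\<^sub>3\<close>, and multiplication of monomials
  is multiset union. Symmetric functions live in this ring of power series;
  the variable \<open>x\<^sub>0\<close> is not used by them.
\<close>

typedef 'a mps = "UNIV :: (nat multiset \<Rightarrow> 'a) set"
  morphisms mps_coeff Abs_mps ..

setup_lifting type_definition_mps

lemma mps_eqI: "(\<And>m. mps_coeff f m = mps_coeff g m) \<Longrightarrow> f = g"
  by transfer auto

lemma finite_submultisets: "finite {a. a \<subseteq># (m :: 'b multiset)}"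
proof (induction m)
  case empty
  then show ?case by simp
next
  case (add x m)
  have "{a. a \<subseteq># add_mset x m} \<subseteq> {a. a \<subseteq># m} \<union> add_mset x ` {a. a \<subseteq># m}"
  proof
    fix a assume "a \<in> {a. a \<subseteq># add_mset x m}"
    then have a: "a \<subseteq># add_mset x m" by simp
    show "a \<in> {a. a \<subseteq># m} \<union> add_mset x ` {a. a \<subseteq># m}"
    proof (cases "x \<in># a")
      case True
      then obtain b where b: "a = add_mset x b" by (metis multi_member_split)
      with a show ?thesis by auto
    next
      case False
      with a have "a \<subseteq># m"
        by (metis diff_single_trivial subset_eq_diff_conv add_mset_add_single)
      then show ?thesis by simp
    qed
  qed
  then show ?case using add by (meson finite_UnI finite_imageI finite_subset)
qed

instantiation mps :: (comm_ring_1) comm_ring_1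
begin

lift_definition zero_mps :: "'a mps" is "\<lambda>_. 0" .
lift_definition one_mps :: "'a mps" is "\<lambda>m. if m = {#} then 1 else 0" .
lift_definition plus_mps :: "'a mps \<Rightarrow> 'a mps \<Rightarrow> 'a mps" is "\<lambda>f g m. f m + g m" .
lift_definition minus_mps :: "'a mps \<Rightarrow> 'a mps \<Rightarrow> 'a mps" is "\<lambda>f g m. f m - g m" .
lift_definition uminus_mps :: "'a mps \<Rightarrow> 'a mps" is "\<lambda>f m. - f m" .
lift_definition times_mps :: "'a mps \<Rightarrow> 'a mps \<Rightarrow> 'a mps"
  is "\<lambda>f g m. \<Sum>a | a \<subseteq># m. f a * g (m - a)" .

instance
proof
  fix f g h :: "'a mps"
  show "f + g + h = f + (g + h)" "f + g = g + f" "0 + f = f" "- f + f = 0" "f - g = f + - g"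
    by (transfer; simp add: algebra_simps)+
  show "f * g * h = f * (g * h)"
  proof (transfer, rule ext)
    fix f g h :: "nat multiset \<Rightarrow> 'a" and m :: "nat multiset"
    have "(\<Sum>a | a \<subseteq># m. (\<Sum>b | b \<subseteq># a. f b * g (a - b)) * h (m - a)) =
        (\<Sum>(a, b) \<in> (SIGMA a:{a. a \<subseteq># m}. {b. b \<subseteq># a}). f b * g (a - b) * h (m - a))"
      by (simp add: sum_distrib_right sum.Sigma finite_submultisets)
    also have "\<dots> = (\<Sum>(a, b) \<in> (SIGMA a:{a. a \<subseteq># m}. {b. b \<subseteq># m - a}).
        f a * (g b * h (m - a - b)))"
      by (rule sum.reindex_bij_witness[where i = "\<lambda>(a, b). (a + b, a)" and j = "\<lambda>(a, b). (b, a - b)"])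
         (auto simp: mult.assoc subset_eq_diff_conv subset_mset.le_diff_conv2 add.commute
           intro: subset_mset.order_trans)
    also have "\<dots> = (\<Sum>a | a \<subseteq># m. f a * (\<Sum>b | b \<subseteq># m - a. g b * h (m - a - b)))"
      by (simp add: sum_distrib_left sum.Sigma finite_submultisets)
    finally show "(\<Sum>a | a \<subseteq># m. (\<Sum>b | b \<subseteq># a. f b * g (a - b)) * h (m - a)) =
        (\<Sum>a | a \<subseteq># m. f a * (\<Sum>b | b \<subseteq># m - a. g b * h (m - a - b)))" .
  qed
  show "f * g = g * f"
  proof (transfer, rule ext)
    fix f g :: "nat multiset \<Rightarrow> 'a" and m :: "nat multiset"
    have mm: "m - (m - a) = a" if "a \<subseteq># m" for a
      using that by (auto simp: multiset_eq_iff subseteq_mset_def)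
    show "(\<Sum>a | a \<subseteq># m. f a * g (m - a)) = (\<Sum>a | a \<subseteq># m. g a * f (m - a))"
      by (rule sum.reindex_bij_witness[where i = "\<lambda>a. m - a" and j = "\<lambda>a. m - a"])
         (simp_all add: mm mult.commute)
  qed
  show "1 * f = f"
  proof (transfer, rule ext)
    fix f :: "nat multiset \<Rightarrow> 'a" and m :: "nat multiset"
    have "(\<Sum>a | a \<subseteq># m. (if a = {#} then 1 else 0) * f (m - a)) =
        (\<Sum>a | a \<subseteq># m. if a = {#} then f m else 0)"
      by (intro sum.cong) auto
    then show "(\<Sum>a | a \<subseteq># m. (if a = {#} then 1 else 0) * f (m - a)) = f m"
      by (simp add: sum.delta finite_submultisets)
  qed
  show "(f + g) * h = f * h + g * h"
    by transfer (simp add: algebra_simps sum.distrib)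
  show "(0 :: 'a mps) \<noteq> 1"
    by transfer (auto simp: fun_eq_iff)
qed

end

lift_definition mps_scale :: "'a :: comm_ring_1 \<Rightarrow> 'a mps \<Rightarrow> 'a mps" (infixr "*\<^sub>\<Lambda>" 75)
  is "\<lambda>c f m. c * f m" .

lift_definition mps_var :: "nat \<Rightarrow> 'a :: comm_ring_1 mps"
  is "\<lambda>i m. if m = {#i#} then 1 else 0" .

text \<open>
  The coefficientwise sum of a possibly infinite family. It is meaningful when each monomial occurs
  in only finitely many members of the family, as is the case for both uses below
  (\<open>coeff_elem_sym\<close> and \<open>coeff_chromatic_sym\<close>).
\<close>

lift_definition mps_infsum :: "('b \<Rightarrow> 'a :: comm_ring_1 mps) \<Rightarrow> 'b set \<Rightarrow> 'a mps"
  is "\<lambda>F S m. \<Sum>k | k \<in> S \<and> F k m \<noteq> 0. F k m" .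

lemma coeff_scale [simp]: "mps_coeff (c *\<^sub>\<Lambda> f) m = c * mps_coeff f m"
  by transfer simp

lemma coeff_prod_var:
  assumes "finite A"
  shows "mps_coeff (\<Prod>v\<in>A. mps_var (k v) :: 'a :: comm_ring_1 mps) m =
    (if m = image_mset k (mset_set A) then 1 else 0)"
  using assms
proof (induction A arbitrary: m)
  case empty
  show ?case by (simp add: one_mps.rep_eq)
next
  case (insert v A)
  have "mps_coeff (\<Prod>v\<in>insert v A. mps_var (k v) :: 'a mps) m =
      (\<Sum>a | a \<subseteq># m. if a = {#k v#} then (if m - a = image_mset k (mset_set A) then 1 else 0) else 0)"
    using insert by (auto simp: times_mps.rep_eq mps_var.rep_eq intro!: sum.cong)
  also have "\<dots> = (if k v \<in># m \<and> m - {#k v#} = image_mset k (mset_set A) then 1 else 0)"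
    by (simp add: sum.delta finite_submultisets)
  also have "(k v \<in># m \<and> m - {#k v#} = image_mset k (mset_set A)) \<longleftrightarrow>
      m = image_mset k (mset_set (insert v A))"
    using insert.hyps by (auto dest!: insert_DiffM)
  finally show ?case .
qed


section \<open>Elementary and chromatic symmetric functions\<close>

definition elem_sym :: "nat \<Rightarrow> 'a :: comm_ring_1 mps" where
  "elem_sym k = mps_infsum (\<lambda>A. \<Prod>i\<in>A. mps_var i) {A. A \<subseteq> {1..} \<and> finite A \<and> card A = k}"

definition elem_sym_comp :: "nat list \<Rightarrow> 'a :: comm_ring_1 mps" where
  "elem_sym_comp I = (\<Prod>i\<leftarrow>I. elem_sym i)"

text \<open>A graph is given by its vertex set and its set of edges, an edge being a set of two vertices.\<close>

definition proper_colorings :: "'v set \<Rightarrow> 'v set set \<Rightarrow> ('v \<Rightarrow> nat) set" where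
  "proper_colorings V E =
    {\<kappa> \<in> V \<rightarrow>\<^sub>E {1..}. \<forall>u\<in>V. \<forall>v\<in>V. {u, v} \<in> E \<longrightarrow> \<kappa> u \<noteq> \<kappa> v}"

definition chromatic_sym :: "'v set \<Rightarrow> 'v set set \<Rightarrow> 'a :: comm_ring_1 mps" where
  "chromatic_sym V E = mps_infsum (\<lambda>\<kappa>. \<Prod>v\<in>V. mps_var (\<kappa> v)) (proper_colorings V E)"

lemma coeff_elem_sym:
  "mps_coeff (elem_sym k :: 'a :: comm_ring_1 mps) m =
    (if size m = k \<and> 0 \<notin># m \<and> (\<forall>i. count m i \<le> 1) then 1 else 0)"
proof -
  let ?S = "{A. A \<subseteq> {1..} \<and> finite A \<and> card A = k}"
  have c: "mps_coeff (\<Prod>i\<in>A. mps_var i :: 'a mps) m = (if m = mset_set A then 1 else 0)"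
    if "A \<in> ?S" for A
    using that coeff_prod_var[of A "\<lambda>i. i" m] by simp
  have eq: "mps_coeff (elem_sym k :: 'a mps) m = (\<Sum>A | A \<in> ?S \<and> m = mset_set A. 1)"
    unfolding elem_sym_def mps_infsum.rep_eq
    using c by (intro sum.cong) (auto split: if_splits)
  show ?thesis
  proof (cases "size m = k \<and> 0 \<notin># m \<and> (\<forall>i. count m i \<le> 1)")
    case True
    have m: "mset_set (set_mset m) = m"
    proof (rule multiset_eqI)
      fix i
      have "count m i \<le> 1" using True by blast
      then show "count (mset_set (set_mset m)) i = count m i"
        by (cases "count m i") (auto simp: count_mset_set' simp flip: count_greater_zero_iff)
    qed
    have "card (set_mset m) = k" using True m by (metis size_mset_set)
    moreover have "set_mset m \<subseteq> {1..}" using True by (auto simp: Suc_le_eq intro: gr0I)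
    ultimately have "set_mset m \<in> {A. A \<in> ?S \<and> m = mset_set A}"
      by (simp add: m)
    moreover have "A = set_mset m" if "A \<in> ?S" "m = mset_set A" for A
      using that by simp
    ultimately have "{A. A \<in> ?S \<and> m = mset_set A} = {set_mset m}" by blast
    then show ?thesis using eq True by simp
  next
    case False
    have "m \<noteq> mset_set A" if "A \<in> ?S" for A
      using that False by (auto simp: count_mset_set' split: if_splits)
    then have none: "{A. A \<in> ?S \<and> m = mset_set A} = {}" by blast
    show ?thesis unfolding eq none using False by auto
  qed
qed

lemma coeff_chromatic_sym:
  assumes "finite V"
  shows "finite {\<kappa> \<in> proper_colorings V E. image_mset \<kappa> (mset_set V) = m}"
    and "mps_coeff (chromatic_sym V E :: 'a :: comm_ring_1 mps) m =
      of_nat (card {\<kappa> \<in> proper_colorings V E. image_mset \<kappa> (mset_set V) = m})"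
proof -
  have "{\<kappa> \<in> proper_colorings V E. image_mset \<kappa> (mset_set V) = m} \<subseteq> V \<rightarrow>\<^sub>E set_mset m"
    using assms by (auto simp: proper_colorings_def PiE_def)
  then show "finite {\<kappa> \<in> proper_colorings V E. image_mset \<kappa> (mset_set V) = m}"
    using assms by (meson finite_PiE finite_set_mset finite_subset)
  have "mps_coeff (chromatic_sym V E :: 'a mps) m =
      (\<Sum>\<kappa> | \<kappa> \<in> proper_colorings V E \<and> image_mset \<kappa> (mset_set V) = m. 1)"
    unfolding chromatic_sym_def mps_infsum.rep_eq
    by (rule sum.cong) (auto simp: coeff_prod_var[OF assms])
  then show "mps_coeff (chromatic_sym V E :: 'a mps) m =
      of_nat (card {\<kappa> \<in> proper_colorings V E. image_mset \<kappa> (mset_set V) = m})"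
    by simp
qed


section \<open>Compositions\<close>

definition compositions :: "nat \<Rightarrow> nat list set" where
  "compositions n = {I. (\<forall>i\<in>set I. 1 \<le> i) \<and> sum_list I = n}"

lemma finite_compositions: "finite (compositions n)"
proof (rule finite_subset)
  have "length I \<le> sum_list I" if "\<forall>i\<in>set I. 1 \<le> i" for I :: "nat list"
    using that by (induction I) auto
  then show "compositions n \<subseteq> {I. set I \<subseteq> {..n} \<and> length I \<le> n}"
    by (auto simp: compositions_def member_le_sum_list)
  show "finite {I. set I \<subseteq> {..n} \<and> length I \<le> n}"
    by (rule finite_lists_length_le) simp
qed

definition comp_weight :: "nat list \<Rightarrow> rat" where
  "comp_weight I = of_nat (hd I) * (\<Prod>i\<leftarrow>tl I. of_nat i - 1)"

text \<open>Both are meant for \<open>c \<le> sum_list I\<close> only; the subtraction in \<open>Theta_plus\<close> is then exact.\<close>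

definition sigma_plus :: "nat list \<Rightarrow> nat \<Rightarrow> nat" where
  "sigma_plus I c = Min {sum_list (take k I) | k. k \<le> length I \<and> c \<le> sum_list (take k I)}"

definition Theta_plus :: "nat list \<Rightarrow> nat \<Rightarrow> nat" where
  "Theta_plus I c = sigma_plus I c - c"


section \<open>The generalized bull \<open>K(1\<^sup>a 2 1\<^bsup>n-a-2\<^esup>)\<close>\<close>

definition path_edges :: "nat \<Rightarrow> nat set set" where
  "path_edges n = {{i, i + 1} | i. 1 \<le> i \<and> i < n}"

definition bull_edges :: "nat \<Rightarrow> nat \<Rightarrow> nat set set" where
  "bull_edges a n = insert {a, a + 2} (path_edges n)"

end

theory Submission
  imports Defs
begin

text \<open>
  Write \<open>P\<^sub>n\<close> for the chromatic symmetric function of the path. Triple deletion in the triangle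
  of the bull gives \<open>2 P\<^sub>n + e\<^sub>1 P\<^bsub>n-1\<^esub> - P\<^sub>a P\<^bsub>n-a\<^esub> - P\<^bsub>a+1\<^esub> P\<^bsub>n-a-1\<^esub>\<close> for its chromatic
  symmetric function. A bijection on pairs of a set and a word without equal neighbours, which moves
  a marked element of the set to the front of the word, gives
  \<open>P\<^sub>n = e\<^sub>n + \<Sum>\<^sub>k (k - 1) e\<^sub>k P\<^bsub>n-k\<^esub>\<close>. Splitting off the last part of a composition shows that
  \<open>\<Sum>\<^sub>I w\<^sub>I e\<^sub>I\<close> satisfies the same recurrence.

  Let \<open>C\<^sub>n = \<Sum>\<^sub>I \<Prod>\<^sub>j (i\<^sub>j - 1) e\<^sub>I\<close>. Cutting compositions at the first partial sum that is at least
  \<open>a\<close>, those with \<open>\<Theta>\<^sup>+(a) = t \<le> 1\<close> contribute \<open>P\<^bsub>a+t\<^esub> C\<^bsub>n-a-t\<^esub>\<close> to \<open>P\<^sub>n\<close>. The factor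
  \<open>(i - 2) / (i - 1)\<close> on the last part \<open>i \<ge> 3\<close> replaces \<open>C\<^sub>m\<close> by
  \<open>2 C\<^sub>m - P\<^sub>m + e\<^sub>1 C\<^bsub>m-1\<^esub>\<close> for \<open>m \<ge> 1\<close>, and the theorem follows by comparing terms.
\<close>


section \<open>Generating functions of weighted sets\<close>

lift_definition mps_gf :: "'b set \<Rightarrow> ('b \<Rightarrow> nat multiset) \<Rightarrow> 'a :: comm_ring_1 mps"
  is "\<lambda>S f m. of_nat (card {x \<in> S. f x = m})" .

definition finite_fibres :: "'b set \<Rightarrow> ('b \<Rightarrow> 'c) \<Rightarrow> bool" where
  "finite_fibres S f \<longleftrightarrow> (\<forall>m. finite {x \<in> S. f x = m})"

lemma mps_gf_empty: "mps_gf {} f = 0"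
  by (rule mps_eqI) (simp add: mps_gf.rep_eq zero_mps.rep_eq)

lemma mps_gf_reindex_bij:
  assumes "bij_betw h S T" and "\<And>x. x \<in> S \<Longrightarrow> g (h x) = f x"
  shows "mps_gf S f = mps_gf T g"
proof (rule mps_eqI)
  fix m
  have "bij_betw h {x \<in> S. f x = m} {y \<in> T. g y = m}"
    using assms unfolding bij_betw_def by (auto simp: inj_on_def)
  then show "mps_coeff (mps_gf S f) m = mps_coeff (mps_gf T g) m"
    by (simp add: mps_gf.rep_eq bij_betw_same_card)
qed

lemma mps_gf_split:
  assumes "finite_fibres S f"
  shows "mps_gf S f = mps_gf {x \<in> S. P x} f + mps_gf {x \<in> S. \<not> P x} f"
    (is "_ = ?g")
proof (rule mps_eqI)
  fix m
  let ?F = "{x \<in> S. f x = m}"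
  have "?F \<inter> {x. P x} = {x \<in> {x \<in> S. P x}. f x = m}"
    and "?F - {x. P x} = {x \<in> {x \<in> S. \<not> P x}. f x = m}"
    by auto
  moreover have "card ?F = card (?F \<inter> {x. P x}) + card (?F - {x. P x})"
    using assms by (intro card_Int_Diff) (simp add: finite_fibres_def)
  ultimately show "mps_coeff (mps_gf S f) m = mps_coeff ?g m"
    by (simp add: mps_gf.rep_eq plus_mps.rep_eq)
qed

lemma Times_fibre_eq_UN:
  "{z \<in> S \<times> T. f (fst z) + g (snd z) = m} =
    (\<Union>a\<in>{a. a \<subseteq># m}. {x \<in> S. f x = a} \<times> {y \<in> T. g y = m - a})"
  by (auto simp: subset_mset.add_diff_inverse)

lemma finite_fibres_Times:
  assumes "finite_fibres S f" and "finite_fibres T g"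
  shows "finite_fibres (S \<times> T) (\<lambda>z. f (fst z) + g (snd z) :: 'b multiset)"
  unfolding finite_fibres_def Times_fibre_eq_UN
  using assms by (auto simp: finite_fibres_def finite_submultisets)

lemma mps_gf_Times:
  assumes "finite_fibres S f" and "finite_fibres T g"
  shows "mps_gf (S \<times> T) (\<lambda>z. f (fst z) + g (snd z)) = mps_gf S f * mps_gf T g"
proof (rule mps_eqI)
  fix m
  have "card {z \<in> S \<times> T. f (fst z) + g (snd z) = m} =
      (\<Sum>a | a \<subseteq># m. card ({x \<in> S. f x = a} \<times> {y \<in> T. g y = m - a}))"
    unfolding Times_fibre_eq_UN
    using assms by (intro card_UN_disjoint) (auto simp: finite_fibres_def finite_submultisets)
  then show "mps_coeff (mps_gf (S \<times> T) (\<lambda>z. f (fst z) + g (snd z))) m =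
      mps_coeff (mps_gf S f * mps_gf T g) m"
    by (simp add: mps_gf.rep_eq times_mps.rep_eq card_cartesian_product)
qed

lemma Sigma_fibre_eq:
  "{z \<in> (SIGMA x:S. M x). f (fst z) = m} = (SIGMA x:{x \<in> S. f x = m}. M x)"
  by auto

lemma finite_fibres_Sigma:
  assumes "finite_fibres S f" and "\<And>x. x \<in> S \<Longrightarrow> finite (M x)"
  shows "finite_fibres (SIGMA x:S. M x) (\<lambda>z. f (fst z))"
  unfolding finite_fibres_def Sigma_fibre_eq
  using assms by (auto simp: finite_fibres_def intro!: finite_SigmaI)

lemma coeff_of_nat_times: "mps_coeff (of_nat k * f) m = of_nat k * mps_coeff f m"
  by (induction k) (simp_all add: zero_mps.rep_eq plus_mps.rep_eq algebra_simps)

lemma mps_gf_Sigma_card: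
  assumes "finite_fibres S f" and "\<And>x. x \<in> S \<Longrightarrow> finite (M x) \<and> card (M x) = k"
  shows "mps_gf (SIGMA x:S. M x) (\<lambda>z. f (fst z)) = of_nat k * mps_gf S f"
proof (rule mps_eqI)
  fix m
  have "card {z \<in> (SIGMA x:S. M x). f (fst z) = m} = (\<Sum>x | x \<in> S \<and> f x = m. card (M x))"
    unfolding Sigma_fibre_eq
    using assms by (intro card_SigmaI) (auto simp: finite_fibres_def)
  also have "\<dots> = card {x \<in> S. f x = m} * k"
    using assms(2) by simp
  finally show "mps_coeff (mps_gf (SIGMA x:S. M x) (\<lambda>z. f (fst z))) m =
      mps_coeff (of_nat k * mps_gf S f) m"
    by (simp add: coeff_of_nat_times mps_gf.rep_eq mult.commute)
qed


section \<open>Chromatic symmetric functions\<close>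

abbreviation color_mset :: "'v set \<Rightarrow> ('v \<Rightarrow> nat) \<Rightarrow> nat multiset" where
  "color_mset V \<kappa> \<equiv> image_mset \<kappa> (mset_set V)"

lemma chromatic_sym_eq_mps_gf:
  "finite V \<Longrightarrow> chromatic_sym V E = mps_gf (proper_colorings V E) (color_mset V)"
  by (rule mps_eqI) (simp add: coeff_chromatic_sym mps_gf.rep_eq)

lemma finite_fibres_proper_colorings:
  "finite V \<Longrightarrow> finite_fibres (proper_colorings V E) (color_mset V)"
  by (simp add: finite_fibres_def coeff_chromatic_sym)

lemma restrict_proper_coloring: "\<kappa> \<in> proper_colorings V E \<Longrightarrow> restrict \<kappa> V = \<kappa>"
  by (auto simp: proper_colorings_def)

lemma color_mset_restrict: "finite V \<Longrightarrow> color_mset V (restrict \<kappa> V) = color_mset V \<kappa>"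
  by (intro image_mset_cong) simp

lemma color_mset_bij:
  assumes "bij_betw f V W"
  shows "color_mset V (\<kappa> \<circ> f) = color_mset W \<kappa>"
  using image_mset_mset_set[OF bij_betw_imp_inj_on[OF assms]] bij_betw_imp_surj_on[OF assms]
  by (metis multiset.map_comp)

lemma bij_betw_proper_colorings_iso:
  assumes f: "bij_betw f V W"
    and edges: "\<And>u v. u \<in> V \<Longrightarrow> v \<in> V \<Longrightarrow> {f u, f v} \<in> F \<longleftrightarrow> {u, v} \<in> E"
  shows "bij_betw (\<lambda>\<kappa>. restrict (\<kappa> \<circ> f) V) (proper_colorings W F) (proper_colorings V E)"
proof (rule bij_betw_byWitness)
  let ?g = "inv_into V f"
  have g: "?g w \<in> V" "f (?g w) = w" if "w \<in> W" for w
    using that f by (auto simp: bij_betw_def inv_into_into f_inv_into_f)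
  have f_image: "f v \<in> W" "?g (f v) = v" if "v \<in> V" for v
    using that f by (auto simp: bij_betw_def)
  show "(\<lambda>\<kappa>. restrict (\<kappa> \<circ> f) V) ` proper_colorings W F \<subseteq> proper_colorings V E"
    using f_image(1) edges by (auto simp: proper_colorings_def)
  show "(\<lambda>\<kappa>. restrict (\<kappa> \<circ> ?g) W) ` proper_colorings V E \<subseteq> proper_colorings W F"
    using g edges[OF g(1) g(1)] by (auto simp: proper_colorings_def)
  have "restrict (restrict (\<kappa> \<circ> f) V \<circ> ?g) W = restrict \<kappa> W" for \<kappa> :: "'b \<Rightarrow> nat"
    using g by (intro restrict_ext) simp
  then show "\<forall>\<kappa>\<in>proper_colorings W F. restrict (restrict (\<kappa> \<circ> f) V \<circ> ?g) W = \<kappa>"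
    by (simp add: restrict_proper_coloring)
  have "restrict (restrict (\<kappa> \<circ> ?g) W \<circ> f) V = restrict \<kappa> V" for \<kappa> :: "'a \<Rightarrow> nat"
    using f_image by (intro restrict_ext) simp
  then show "\<forall>\<kappa>\<in>proper_colorings V E. restrict (restrict (\<kappa> \<circ> ?g) W \<circ> f) V = \<kappa>"
    by (simp add: restrict_proper_coloring)
qed

lemma chromatic_sym_iso:
  assumes "finite V" and f: "bij_betw f V W"
    and edges: "\<And>u v. u \<in> V \<Longrightarrow> v \<in> V \<Longrightarrow> {f u, f v} \<in> F \<longleftrightarrow> {u, v} \<in> E"
  shows "(chromatic_sym W F :: 'c :: comm_ring_1 mps) = chromatic_sym V E"
proof -
  have "finite W" using assms(1) f bij_betw_finite by blast
  have "(mps_gf (proper_colorings W F) (color_mset W) :: 'c mps) =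
      mps_gf (proper_colorings V E) (color_mset V)"
    using bij_betw_proper_colorings_iso[OF f edges]
    by (rule mps_gf_reindex_bij)
      (simp_all only: color_mset_restrict[OF assms(1)] color_mset_bij[OF f])
  then show ?thesis using \<open>finite V\<close> \<open>finite W\<close> by (simp add: chromatic_sym_eq_mps_gf)
qed

lemma bij_betw_proper_colorings_disjoint_Un:
  assumes disjoint: "V \<inter> W = {}"
    and no_edges: "\<And>v w. v \<in> V \<Longrightarrow> w \<in> W \<Longrightarrow> {v, w} \<notin> E"
  shows "bij_betw (\<lambda>\<kappa>. (restrict \<kappa> V, restrict \<kappa> W)) (proper_colorings (V \<union> W) E)
    (proper_colorings V E \<times> proper_colorings W E)"
proof -
  define join where "join \<kappa> \<mu> = restrict (\<lambda>v. if v \<in> V then \<kappa> v else \<mu> v) (V \<union> W)"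
    for \<kappa> \<mu> :: "'a \<Rightarrow> nat"
  have join_proper: "join \<kappa> \<mu> \<in> proper_colorings (V \<union> W) E"
    if "\<kappa> \<in> proper_colorings V E" "\<mu> \<in> proper_colorings W E" for \<kappa> \<mu>
  proof -
    have \<kappa>: "\<kappa> \<in> V \<rightarrow> {1..}" "\<forall>u\<in>V. \<forall>v\<in>V. {u, v} \<in> E \<longrightarrow> \<kappa> u \<noteq> \<kappa> v"
      and \<mu>: "\<mu> \<in> W \<rightarrow> {1..}" "\<forall>u\<in>W. \<forall>v\<in>W. {u, v} \<in> E \<longrightarrow> \<mu> u \<noteq> \<mu> v"
      using that by (auto simp: proper_colorings_def)
    have "join \<kappa> \<mu> u \<noteq> join \<kappa> \<mu> v" if "u \<in> V \<union> W" "v \<in> V \<union> W" "{u, v} \<in> E" for u v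
      using that \<kappa>(2) \<mu>(2) no_edges[of u v] no_edges[of v u]
      by (auto simp: join_def insert_commute)
    moreover have "join \<kappa> \<mu> \<in> V \<union> W \<rightarrow>\<^sub>E {1..}"
      using \<kappa>(1) \<mu>(1) by (auto simp: join_def)
    ultimately show ?thesis by (simp add: proper_colorings_def)
  qed
  have "join (restrict \<kappa> V) (restrict \<kappa> W) = restrict \<kappa> (V \<union> W)" for \<kappa> :: "'a \<Rightarrow> nat"
    unfolding join_def by (rule restrict_ext) auto
  then have join_restrict: "join (restrict \<kappa> V) (restrict \<kappa> W) = \<kappa>"
    if "\<kappa> \<in> proper_colorings (V \<union> W) E" for \<kappa>
    using that by (simp add: restrict_proper_coloring)
  have "restrict (join \<kappa> \<mu>) V = restrict \<kappa> V" "restrict (join \<kappa> \<mu>) W = restrict \<mu> W" for \<kappa> \<mu>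
    unfolding join_def using disjoint by (auto intro!: restrict_ext simp del: restrict_restrict)
  then have restrict_join: "restrict (join \<kappa> \<mu>) V = \<kappa>" "restrict (join \<kappa> \<mu>) W = \<mu>"
    if "\<kappa> \<in> proper_colorings V E" "\<mu> \<in> proper_colorings W E" for \<kappa> \<mu>
    using that by (simp_all add: restrict_proper_coloring)
  have "restrict \<kappa> V \<in> proper_colorings V E" "restrict \<kappa> W \<in> proper_colorings W E"
    if "\<kappa> \<in> proper_colorings (V \<union> W) E" for \<kappa>
    using that by (auto simp: proper_colorings_def)
  then show ?thesis
    by (intro bij_betw_byWitness[where f' = "\<lambda>(\<kappa>, \<mu>). join \<kappa> \<mu>"])
      (auto simp: join_proper join_restrict restrict_join)
qed

lemma chromatic_sym_disjoint_Un:
  assumes "finite V" "finite W" "V \<inter> W = {}"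
    and "\<And>v w. v \<in> V \<Longrightarrow> w \<in> W \<Longrightarrow> {v, w} \<notin> E"
  shows "(chromatic_sym (V \<union> W) E :: 'b :: comm_ring_1 mps) =
    chromatic_sym V E * chromatic_sym W E"
proof -
  have "(mps_gf (proper_colorings (V \<union> W) E) (color_mset (V \<union> W)) :: 'b mps) =
      mps_gf (proper_colorings V E \<times> proper_colorings W E)
        (\<lambda>z. color_mset V (fst z) + color_mset W (snd z))"
    using assms by (intro mps_gf_reindex_bij[OF bij_betw_proper_colorings_disjoint_Un])
      (simp_all add: mset_set_Union color_mset_restrict)
  then show ?thesis
    using assms(1,2) by (simp add: chromatic_sym_eq_mps_gf
        mps_gf_Times[OF finite_fibres_proper_colorings finite_fibres_proper_colorings])
qed

lemma proper_colorings_insert_edge: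
  "u \<in> V \<Longrightarrow> v \<in> V \<Longrightarrow>
    proper_colorings V (insert {u, v} E) = {\<kappa> \<in> proper_colorings V E. \<kappa> u \<noteq> \<kappa> v}"
  by (auto simp: proper_colorings_def doubleton_eq_iff)

lemma chromatic_sym_insert_edge:
  assumes "finite V" "u \<in> V" "v \<in> V"
  shows "chromatic_sym V (insert {u, v} E) =
    chromatic_sym V E - mps_gf {\<kappa> \<in> proper_colorings V E. \<kappa> u = \<kappa> v} (color_mset V)"
  using assms by (simp add: chromatic_sym_eq_mps_gf proper_colorings_insert_edge
      mps_gf_split[OF finite_fibres_proper_colorings, of V E "\<lambda>\<kappa>. \<kappa> u = \<kappa> v"])

lemma chromatic_sym_triple_deletion:
  assumes "finite V" "u \<in> V" "v \<in> V" "w \<in> V"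
  shows "chromatic_sym V (insert {u, v} (insert {v, w} (insert {u, w} E))) =
    chromatic_sym V (insert {v, w} (insert {u, w} E)) +
      (chromatic_sym V (insert {u, v} (insert {u, w} E)) - chromatic_sym V (insert {u, w} E))"
proof -
  let ?F = "insert {u, w} E"
  have "{\<kappa> \<in> proper_colorings V (insert {v, w} ?F). \<kappa> u = \<kappa> v} =
      {\<kappa> \<in> proper_colorings V ?F. \<kappa> u = \<kappa> v}"
    using assms by (auto simp: proper_colorings_insert_edge)
  then show ?thesis
    using assms by (simp add: chromatic_sym_insert_edge[of V u v])
qed

lemma chromatic_sym_triangle:
  assumes "finite V" "u \<in> V" "v \<in> V" "w \<in> V"
  shows "chromatic_sym V (insert {u, v} (insert {v, w} (insert {u, w} E))) =
    2 * chromatic_sym V (insert {u, v} (insert {v, w} E)) + chromatic_sym V (insert {u, w} E)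
      - chromatic_sym V (insert {u, v} E) - chromatic_sym V (insert {v, w} E)"
    (is "?X = 2 * ?uv_vw + ?uw - ?uv - ?vw")
proof -
  let ?uv_uw = "chromatic_sym V (insert {u, v} (insert {u, w} E))"
  let ?vw_uw = "chromatic_sym V (insert {v, w} (insert {u, w} E))"
  have "?vw_uw + (?uv_uw - ?uw) = ?X"
    using assms by (rule chromatic_sym_triple_deletion[symmetric])
  also have "?X = ?vw_uw + (?uv_vw - ?vw)"
    using chromatic_sym_triple_deletion[of V v u w E] assms by (simp add: insert_commute)
  finally have "?uv_uw = ?uw + ?uv_vw - ?vw" by (simp add: algebra_simps)
  moreover have "?X = ?uv_uw + (?uv_vw - ?uv)"
    using chromatic_sym_triple_deletion[of V v w u E] assms by (simp add: insert_commute)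
  ultimately show ?thesis by simp
qed


section \<open>Paths\<close>

definition path_sym :: "nat \<Rightarrow> 'a :: comm_ring_1 mps" where
  "path_sym n = chromatic_sym {1..n} (path_edges n)"

lemma doubleton_in_path_edges_iff:
  "{u, v} \<in> path_edges n \<longleftrightarrow>
    v = Suc u \<and> 1 \<le> u \<and> u < n \<or> u = Suc v \<and> 1 \<le> v \<and> v < n"
  by (auto simp: path_edges_def doubleton_eq_iff)

lemma singleton_notin_path_edges: "{v} \<notin> path_edges n"
  using doubleton_in_path_edges_iff[of v v n] by simp

lemma chromatic_sym_eq_path_sym:
  assumes "bij_betw f {1..n} V"
    and "\<And>i j. i \<in> {1..n} \<Longrightarrow> j \<in> {1..n} \<Longrightarrow> {f i, f j} \<in> E \<longleftrightarrow> {i, j} \<in> path_edges n"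
  shows "chromatic_sym V E = path_sym n"
  unfolding path_sym_def using assms by (intro chromatic_sym_iso) auto

lemma chromatic_sym_path_delete_edge:
  assumes "k \<le> n"
  shows "chromatic_sym {1..n} (path_edges n - {{k, k + 1}}) = path_sym k * path_sym (n - k)"
proof -
  let ?E = "path_edges n - {{k, k + 1}}"
  have "{1..k} \<union> {k + 1..n} = {1..n}" using assms by auto
  then have "chromatic_sym {1..n} ?E = chromatic_sym ({1..k} \<union> {k + 1..n}) ?E" by (simp only:)
  also have "\<dots> = chromatic_sym {1..k} ?E * chromatic_sym {k + 1..n} ?E"
    by (rule chromatic_sym_disjoint_Un) (auto simp: doubleton_in_path_edges_iff doubleton_eq_iff)
  also have "chromatic_sym {1..k} ?E = path_sym k"
    using assms by (intro chromatic_sym_eq_path_sym[where f = id])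
      (auto simp: doubleton_in_path_edges_iff doubleton_eq_iff)
  also have "chromatic_sym {k + 1..n} ?E = path_sym (n - k)"
  proof (rule chromatic_sym_eq_path_sym[where f = "\<lambda>i. i + k"])
    show "bij_betw (\<lambda>i. i + k) {1..n - k} {k + 1..n}"
      using assms by (intro bij_betw_byWitness[where f' = "\<lambda>i. i - k"]) auto
  qed (auto simp: doubleton_in_path_edges_iff doubleton_eq_iff)
  finally show ?thesis .
qed


section \<open>The recurrence for paths\<close>

definition smirnov_words :: "nat \<Rightarrow> nat list set" where
  "smirnov_words n = {w. length w = n \<and> 0 \<notin> set w \<and> distinct_adj w}"

lemma proper_colorings_path:
  "proper_colorings {1..n} (path_edges n) =
    {\<kappa> \<in> {1..n} \<rightarrow>\<^sub>E {1..}. \<forall>i. 1 \<le> i \<and> i < n \<longrightarrow> \<kappa> i \<noteq> \<kappa> (Suc i)}"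
  by (fastforce simp: proper_colorings_def doubleton_in_path_edges_iff)

lemma smirnov_word_iff:
  "w \<in> smirnov_words n \<longleftrightarrow>
    length w = n \<and> (\<forall>i<n. 1 \<le> w ! i) \<and> (\<forall>i. Suc i < n \<longrightarrow> w ! i \<noteq> w ! Suc i)"
  by (auto simp: smirnov_words_def distinct_adj_conv_nth in_set_conv_nth Suc_le_eq)

lemma bij_betw_proper_colorings_smirnov_words:
  "bij_betw (\<lambda>\<kappa>. map (\<kappa> \<circ> Suc) [0..<n]) (proper_colorings {1..n} (path_edges n)) (smirnov_words n)"
proof (rule bij_betw_byWitness)
  let ?word = "\<lambda>\<kappa> :: nat \<Rightarrow> nat. map (\<kappa> \<circ> Suc) [0..<n]"
  let ?coloring = "\<lambda>w :: nat list. restrict (\<lambda>i. w ! (i - 1)) {1..n}"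
  have "?coloring (?word \<kappa>) = restrict \<kappa> {1..n}" for \<kappa>
    by (rule restrict_ext) auto
  then show "\<forall>\<kappa>\<in>proper_colorings {1..n} (path_edges n). ?coloring (?word \<kappa>) = \<kappa>"
    by (auto simp only: restrict_proper_coloring)
  show "\<forall>w\<in>smirnov_words n. ?word (?coloring w) = w"
    by (auto simp: smirnov_words_def intro!: nth_equalityI)
  show "?word ` proper_colorings {1..n} (path_edges n) \<subseteq> smirnov_words n"
    unfolding proper_colorings_path by (auto simp: smirnov_word_iff PiE_iff)
  show "?coloring ` smirnov_words n \<subseteq> proper_colorings {1..n} (path_edges n)"
  proof clarify
    fix w assume w: "w \<in> smirnov_words n"
    have "w ! (i - 1) \<noteq> w ! i" if "1 \<le> i" "i < n" for i
      using w that by (cases i) (auto simp: smirnov_word_iff)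
    then show "?coloring w \<in> proper_colorings {1..n} (path_edges n)"
      using w unfolding proper_colorings_path by (auto simp: smirnov_word_iff)
  qed
qed

lemma path_sym_eq_mps_gf: "path_sym n = mps_gf (smirnov_words n) mset"
proof -
  have "bij_betw Suc {0..<n} {1..n}"
    by (simp add: bij_betw_def image_Suc_atLeastLessThan atLeastLessThanSuc_atLeastAtMost)
  from color_mset_bij[OF this]
  have "mset (map (\<kappa> \<circ> Suc) [0..<n]) = color_mset {1..n} \<kappa>" for \<kappa> :: "nat \<Rightarrow> nat"
    by simp
  then show ?thesis
    unfolding path_sym_def chromatic_sym_eq_mps_gf[OF finite_atLeastAtMost]
    by (intro mps_gf_reindex_bij[OF bij_betw_proper_colorings_smirnov_words])
qed

lemma path_sym_0 [simp]: "path_sym 0 = 1"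
proof (rule mps_eqI)
  fix m
  have "{w \<in> smirnov_words 0. mset w = m} = (if m = {#} then {[]} else {})"
    by (auto simp: smirnov_words_def)
  then show "mps_coeff (path_sym 0) m = mps_coeff 1 m"
    by (simp add: path_sym_eq_mps_gf mps_gf.rep_eq one_mps.rep_eq)
qed

definition positive_sets :: "nat \<Rightarrow> nat set set" where
  "positive_sets k = {A. finite A \<and> 0 \<notin> A \<and> card A = k}"

lemma finite_fibres_mset_set:
  assumes "\<And>A. A \<in> S \<Longrightarrow> finite A"
  shows "finite_fibres S mset_set"
proof -
  have "{A \<in> S. mset_set A = m} \<subseteq> {set_mset m}" for m
    using assms by auto
  then show ?thesis by (auto simp: finite_fibres_def intro: finite_subset)
qed

lemma finite_fibres_mset: "finite_fibres S mset"
proof -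
  have "finite {w \<in> S. mset w = m}" for m
    by (rule finite_subset[of _ "{w. set w \<subseteq> set_mset m \<and> length w = size m}"])
      (auto intro: finite_lists_length_eq)
  then show ?thesis by (simp add: finite_fibres_def)
qed

lemma elem_sym_eq_mps_gf:
  "(elem_sym k :: 'a :: comm_ring_1 mps) = mps_gf (positive_sets k) mset_set" (is "_ = ?g")
proof (rule mps_eqI)
  fix m
  have "{A. A \<subseteq> {1..} \<and> finite A \<and> card A = k} = positive_sets k"
    by (auto simp: positive_sets_def Suc_le_eq intro!: gr0I)
  then have "mps_coeff (elem_sym k :: 'a mps) m =
      (\<Sum>A | A \<in> positive_sets k \<and> mps_coeff (\<Prod>i\<in>A. mps_var i :: 'a mps) m \<noteq> 0.
        mps_coeff (\<Prod>i\<in>A. mps_var i) m)"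
    by (simp only: elem_sym_def mps_infsum.rep_eq)
  also have "\<dots> = (\<Sum>A | A \<in> positive_sets k \<and> mset_set A = m. 1)"
    by (intro sum.cong)
      (auto simp: positive_sets_def coeff_prod_var[where k = "\<lambda>i. i", simplified] split: if_splits)
  finally show "mps_coeff (elem_sym k) m = mps_coeff ?g m"
    by (simp add: mps_gf.rep_eq)
qed

lemma elem_sym_0 [simp]: "elem_sym 0 = 1"
proof (rule mps_eqI)
  show "mps_coeff (elem_sym 0) m = mps_coeff 1 m" for m
    by (cases "m = {#}") (simp_all add: coeff_elem_sym one_mps.rep_eq)
qed

definition set_words :: "nat \<Rightarrow> nat \<Rightarrow> (nat set \<times> nat list) set" where
  "set_words k l = positive_sets k \<times> smirnov_words l"

abbreviation set_word_mset :: "nat set \<times> nat list \<Rightarrow> nat multiset" where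
  "set_word_mset z \<equiv> mset_set (fst z) + mset (snd z)"

lemma finite_fibres_set_words: "finite_fibres (set_words k l) set_word_mset"
  unfolding set_words_def
  by (intro finite_fibres_Times finite_fibres_mset_set finite_fibres_mset)
    (simp add: positive_sets_def)

lemma elem_sym_times_path_sym:
  "elem_sym k * path_sym l = mps_gf (set_words k l) set_word_mset"
  unfolding elem_sym_eq_mps_gf path_sym_eq_mps_gf set_words_def
  by (intro mps_gf_Times[symmetric] finite_fibres_mset_set finite_fibres_mset)
    (simp add: positive_sets_def)

fun head_in_set :: "nat set \<times> nat list \<Rightarrow> bool" where
  "head_in_set (A, w) \<longleftrightarrow> w \<noteq> [] \<and> hd w \<in> A"

definition head_in_sym :: "nat \<Rightarrow> nat \<Rightarrow> 'a :: comm_ring_1 mps" where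
  "head_in_sym k l = mps_gf {z \<in> set_words k l. head_in_set z} set_word_mset"

lemma head_in_sym_0 [simp]: "head_in_sym 0 l = 0" "head_in_sym k 0 = 0"
proof -
  have "{z \<in> set_words 0 l. head_in_set z} = {}" "{z \<in> set_words k 0. head_in_set z} = {}"
    by (auto simp: set_words_def positive_sets_def smirnov_words_def)
  then show "head_in_sym 0 l = 0" "head_in_sym k 0 = 0"
    by (simp_all only: head_in_sym_def mps_gf_empty)
qed

definition marked_set_words :: "nat \<Rightarrow> nat \<Rightarrow> ((nat set \<times> nat list) \<times> nat) set" where
  "marked_set_words k l = (SIGMA z:set_words k l. fst z)"

lemma finite_fibres_marked_set_words:
  "finite_fibres (marked_set_words k l) (\<lambda>y. set_word_mset (fst y))"
  unfolding marked_set_words_def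
  by (intro finite_fibres_Sigma finite_fibres_set_words)
    (auto simp: set_words_def positive_sets_def)

lemma mps_gf_marked_set_words:
  "mps_gf (marked_set_words k l) (\<lambda>y. set_word_mset (fst y)) = of_nat k * (elem_sym k * path_sym l)"
  unfolding marked_set_words_def elem_sym_times_path_sym
  by (intro mps_gf_Sigma_card finite_fibres_set_words) (auto simp: set_words_def positive_sets_def)

fun mark_is_head :: "(nat set \<times> nat list) \<times> nat \<Rightarrow> bool" where
  "mark_is_head ((A, w), x) \<longleftrightarrow> w \<noteq> [] \<and> hd w = x"

lemma bij_betw_move_mark_to_head:
  "bij_betw (\<lambda>((A, w), x). (A - {x}, x # w))
    {y \<in> marked_set_words (Suc k) l. \<not> mark_is_head y}
    {z \<in> set_words k (Suc l). \<not> head_in_set z}"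
  (is "bij_betw ?move ?S ?T")
proof (rule bij_betw_byWitness)
  let ?unmove = "\<lambda>(A, w). ((insert (hd w) A, tl w), hd w)"
  show "\<forall>y\<in>?S. ?unmove (?move y) = y"
    by (auto simp: marked_set_words_def)
  show "\<forall>z\<in>?T. ?move (?unmove z) = z"
    by (auto simp: set_words_def smirnov_words_def length_Suc_conv)
  show "?move ` ?S \<subseteq> ?T"
    by (auto simp: marked_set_words_def set_words_def smirnov_words_def positive_sets_def
        distinct_adj_Cons)
  show "?unmove ` ?T \<subseteq> ?S"
    by (auto simp: marked_set_words_def set_words_def smirnov_words_def positive_sets_def
        distinct_adj_Cons length_Suc_conv)
qed

text \<open>
  A marked element that is already the first letter of the word carries no information; any other
  is moved to the front of the word.
\<close>

lemma elem_sym_times_path_sym_shift: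
  "of_nat (Suc k) * (elem_sym (Suc k) * path_sym l) =
    elem_sym k * path_sym (Suc l) + (head_in_sym (Suc k) l - head_in_sym k (Suc l))"
proof -
  let ?M = "marked_set_words (Suc k) l"
  let ?weight = "\<lambda>y :: (nat set \<times> nat list) \<times> nat. set_word_mset (fst y)"
  have "of_nat (Suc k) * (elem_sym (Suc k) * path_sym l) = mps_gf ?M ?weight"
    by (rule mps_gf_marked_set_words[symmetric])
  also have "\<dots> = mps_gf {y \<in> ?M. mark_is_head y} ?weight +
      mps_gf {y \<in> ?M. \<not> mark_is_head y} ?weight"
    by (rule mps_gf_split[OF finite_fibres_marked_set_words])
  also have "mps_gf {y \<in> ?M. mark_is_head y} ?weight = head_in_sym (Suc k) l"
    unfolding head_in_sym_def
    by (rule mps_gf_reindex_bij[where h = fst])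
      (auto simp: bij_betw_def inj_on_def marked_set_words_def image_iff)
  also have "mps_gf {y \<in> ?M. \<not> mark_is_head y} ?weight =
      mps_gf {z \<in> set_words k (Suc l). \<not> head_in_set z} set_word_mset"
    by (rule mps_gf_reindex_bij[OF bij_betw_move_mark_to_head])
      (auto simp: marked_set_words_def set_words_def positive_sets_def mset_set.remove)
  also have "\<dots> = elem_sym k * path_sym (Suc l) - head_in_sym k (Suc l)"
    unfolding elem_sym_times_path_sym head_in_sym_def
    by (simp add: mps_gf_split[OF finite_fibres_set_words, of k "Suc l" head_in_set])
  finally show ?thesis by (simp add: algebra_simps)
qed

lemma path_sym_recurrence:
  assumes "1 \<le> n"
  shows "(path_sym n :: 'a :: comm_ring_1 mps) =
    elem_sym n + (\<Sum>k=1..n. (of_nat k - 1) * elem_sym k * path_sym (n - k))"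
proof -
  define boundary :: "nat \<Rightarrow> 'a mps" where "boundary k = head_in_sym k (n - k)" for k
  have "(\<Sum>k=1..n. of_nat k * (elem_sym k * path_sym (n - k)) :: 'a mps) =
      (\<Sum>k<n. of_nat (Suc k) * (elem_sym (Suc k) * path_sym (n - Suc k)))"
    by (simp only: One_nat_def sum.atLeast1_atMost_eq)
  also have "\<dots> = (\<Sum>k<n. elem_sym k * path_sym (n - k) + (boundary (Suc k) - boundary k))"
    by (intro sum.cong refl)
      (simp only: boundary_def elem_sym_times_path_sym_shift lessThan_iff Suc_diff_Suc)
  also have "\<dots> = (\<Sum>k<n. elem_sym k * path_sym (n - k))"
    unfolding sum.distrib sum_lessThan_telescope by (simp add: boundary_def)
  also have "\<dots> = path_sym n + (\<Sum>k=1..n. elem_sym k * path_sym (n - k)) - elem_sym n"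
    using assms sum.lessThan_Suc[of "\<lambda>k. elem_sym k * path_sym (n - k)" n]
      sum.lessThan_Suc_shift[of "\<lambda>k. elem_sym k * path_sym (n - k)" n]
    by (simp add: sum.atLeast1_atMost_eq algebra_simps)
  finally show ?thesis
    by (simp add: algebra_simps sum_subtractf)
qed

lemma path_sym_1: "path_sym 1 = elem_sym 1"
  using path_sym_recurrence[of 1] by simp


section \<open>The generalized bull\<close>

lemma chromatic_sym_path_bypass:
  assumes "1 \<le> a" "a + 2 \<le> n"
  shows "chromatic_sym {1..n} (insert {a, a + 2} (path_edges n - {{a, a + 1}, {a + 1, a + 2}})) =
    elem_sym 1 * path_sym (n - 1)"
proof -
  let ?E = "insert {a, a + 2} (path_edges n - {{a, a + 1}, {a + 1, a + 2}})"
  let ?V = "{1..n} - {a + 1}"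
  have "{a + 1} \<union> ?V = {1..n}" using assms by auto
  then have "chromatic_sym {1..n} ?E = chromatic_sym ({a + 1} \<union> ?V) ?E" by (simp only:)
  also have "\<dots> = chromatic_sym {a + 1} ?E * chromatic_sym ?V ?E"
    by (rule chromatic_sym_disjoint_Un) (auto simp: doubleton_in_path_edges_iff doubleton_eq_iff)
  also have "chromatic_sym {a + 1} ?E = elem_sym 1"
    unfolding path_sym_1[symmetric]
    by (rule chromatic_sym_eq_path_sym[where f = "\<lambda>_. a + 1"])
      (auto simp: bij_betw_def singleton_notin_path_edges)
  also have "chromatic_sym ?V ?E = path_sym (n - 1)"
  proof (rule chromatic_sym_eq_path_sym)
    let ?skip = "\<lambda>i. if i \<le> a then i else i + 1"
    show "bij_betw ?skip {1..n - 1} ?V"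
      using assms by (intro bij_betw_byWitness[where f' = "\<lambda>i. if i \<le> a then i else i - 1"]) auto
    show "{?skip i, ?skip j} \<in> ?E \<longleftrightarrow> {i, j} \<in> path_edges (n - 1)"
      if "i \<in> {1..n - 1}" "j \<in> {1..n - 1}" for i j
      using that assms by (auto simp: doubleton_in_path_edges_iff doubleton_eq_iff)
  qed
  finally show ?thesis .
qed

lemma chromatic_sym_bull:
  assumes "1 \<le> a" "a + 2 \<le> n"
  shows "chromatic_sym {1..n} (bull_edges a n) =
    2 * path_sym n + elem_sym 1 * path_sym (n - 1)
      - path_sym (a + 1) * path_sym (n - (a + 1)) - path_sym a * path_sym (n - a)"
proof -
  let ?F = "path_edges n - {{a, a + 1}, {a + 1, a + 2}}"
  have "{a, a + 1} \<in> path_edges n" "{a + 1, a + 2} \<in> path_edges n" "{a, a + 1} \<noteq> {a + 1, a + 2}"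
    using assms by (auto simp: doubleton_in_path_edges_iff doubleton_eq_iff)
  then have "bull_edges a n = insert {a, a + 1} (insert {a + 1, a + 2} (insert {a, a + 2} ?F))"
    and "insert {a, a + 1} (insert {a + 1, a + 2} ?F) = path_edges n"
    and "insert {a, a + 1} ?F = path_edges n - {{a + 1, (a + 1) + 1}}"
    and "insert {a + 1, a + 2} ?F = path_edges n - {{a, a + 1}}"
    unfolding bull_edges_def by auto
  then have "chromatic_sym {1..n} (bull_edges a n) =
      2 * chromatic_sym {1..n} (path_edges n) + chromatic_sym {1..n} (insert {a, a + 2} ?F)
        - chromatic_sym {1..n} (path_edges n - {{a + 1, (a + 1) + 1}})
        - chromatic_sym {1..n} (path_edges n - {{a, a + 1}})"
    using chromatic_sym_triangle[of "{1..n}" a "a + 1" "a + 2" ?F] assms by simp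
  moreover have "a + 1 \<le> n" "a \<le> n" using assms by simp_all
  ultimately show ?thesis
    by (simp only: path_sym_def[symmetric] chromatic_sym_path_delete_edge
        chromatic_sym_path_bypass[OF assms])
qed


section \<open>Sums over compositions\<close>

lemma compositions_0: "compositions 0 = {[]}"
proof (intro equalityI subsetI)
  fix I assume "I \<in> compositions 0"
  then show "I \<in> {[]}" by (cases I) (auto simp: compositions_def)
qed (simp add: compositions_def)

lemma compositions_not_Nil: "I \<in> compositions n \<Longrightarrow> 1 \<le> n \<Longrightarrow> I \<noteq> []"
  by (auto simp: compositions_def)

lemma sum_compositions_Cons:
  assumes "1 \<le> n"
  shows "(\<Sum>I\<in>compositions n. \<phi> I) = (\<Sum>k=1..n. \<Sum>L\<in>compositions (n - k). \<phi> (k # L))"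
proof -
  have "bij_betw (\<lambda>(k, L). k # L) (SIGMA k:{1..n}. compositions (n - k)) (compositions n)"
  proof (rule bij_betw_byWitness[where f' = "\<lambda>I. (hd I, tl I)"])
    have "I = hd I # tl I \<and> (hd I, tl I) \<in> (SIGMA k:{1..n}. compositions (n - k))"
      if "I \<in> compositions n" for I
      using that assms by (cases I) (auto simp: compositions_def)
    then show "(\<lambda>I. (hd I, tl I)) ` compositions n \<subseteq> (SIGMA k:{1..n}. compositions (n - k))"
      and "\<forall>I\<in>compositions n. (\<lambda>(k, L). k # L) (hd I, tl I) = I"
      by auto
  qed (auto simp: compositions_def)
  from sum.reindex_bij_betw[OF this, of \<phi>] show ?thesis
    by (simp add: sum.Sigma finite_compositions case_prod_unfold)
qed

lemma sum_compositions_rev: "(\<Sum>I\<in>compositions n. \<phi> (rev I)) = (\<Sum>I\<in>compositions n. \<phi> I)"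
  by (rule sum.reindex_bij_witness[where i = rev and j = rev]) (auto simp: compositions_def)

lemma sum_compositions_snoc:
  assumes "1 \<le> n"
  shows "(\<Sum>I\<in>compositions n. \<phi> I) = (\<Sum>k=1..n. \<Sum>L\<in>compositions (n - k). \<phi> (L @ [k]))"
proof -
  have "(\<Sum>I\<in>compositions n. \<phi> I) = (\<Sum>I\<in>compositions n. \<phi> (rev I))"
    by (rule sum_compositions_rev[symmetric])
  also have "\<dots> = (\<Sum>k=1..n. \<Sum>L\<in>compositions (n - k). \<phi> (rev L @ [k]))"
    by (simp add: sum_compositions_Cons[OF assms])
  also have "\<dots> = (\<Sum>k=1..n. \<Sum>L\<in>compositions (n - k). \<phi> (L @ [k]))"
    by (simp add: sum_compositions_rev[of "\<lambda>L. \<phi> (L @ [_])"])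
  finally show ?thesis .
qed


section \<open>Expansions in elementary symmetric functions\<close>

interpretation mps_module: module "(*\<^sub>\<Lambda>)"
  by unfold_locales (auto intro!: mps_eqI simp: plus_mps.rep_eq algebra_simps)

lemma mps_scale_mult: "(c * d) *\<^sub>\<Lambda> (f * g) = (c *\<^sub>\<Lambda> f) * (d *\<^sub>\<Lambda> g)"
  by (rule mps_eqI) (simp add: times_mps.rep_eq sum_distrib_left algebra_simps)

lemma mps_scale_of_nat: "of_nat k *\<^sub>\<Lambda> f = of_nat k * f"
  by (rule mps_eqI) (simp add: coeff_of_nat_times)

lemma mps_scale_of_nat_minus_1: "(of_nat k - 1) *\<^sub>\<Lambda> f = (of_nat k - 1) * f"
  by (simp add: mps_module.scale_left_diff_distrib mps_scale_of_nat left_diff_distrib)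

lemma mps_scale_numeral_mult: "(numeral k * c) *\<^sub>\<Lambda> f = numeral k * (c *\<^sub>\<Lambda> f)"
  using mps_scale_of_nat[of "numeral k" "c *\<^sub>\<Lambda> f"] by simp

lemma scale_elem_sym_comp_snoc:
  "c *\<^sub>\<Lambda> elem_sym_comp (I @ [k]) = elem_sym k * (c *\<^sub>\<Lambda> elem_sym_comp I)"
  using mps_scale_mult[of c 1 "elem_sym_comp I" "elem_sym k"]
  by (simp add: elem_sym_comp_def mult.commute)

abbreviation weighted_elem_sym :: "nat list \<Rightarrow> rat mps" where
  "weighted_elem_sym I \<equiv> comp_weight I *\<^sub>\<Lambda> elem_sym_comp I"

definition tail_term :: "nat list \<Rightarrow> 'a :: comm_ring_1 mps" where
  "tail_term L = (\<Prod>i\<leftarrow>L. (of_nat i - 1) * elem_sym i)"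

definition tail_sym :: "nat \<Rightarrow> 'a :: comm_ring_1 mps" where
  "tail_sym n = (\<Sum>L\<in>compositions n. tail_term L)"

definition last_reduced_tail_term :: "nat list \<Rightarrow> 'a :: comm_ring_1 mps" where
  "last_reduced_tail_term L = of_nat (last L - 2) * elem_sym (last L) * tail_term (butlast L)"

lemma tail_term_simps [simp]:
  "tail_term [] = 1"
  "tail_term (k # L) = (of_nat k - 1) * elem_sym k * tail_term L"
  "tail_term (K @ L) = tail_term K * tail_term L"
  by (simp_all add: tail_term_def)

lemma scale_elem_sym_comp_eq_tail_term:
  "(\<Prod>i\<leftarrow>L. of_nat i - 1) *\<^sub>\<Lambda> elem_sym_comp L = tail_term L"
proof (induction L)
  case (Cons k L)
  then show ?case
    by (simp add: elem_sym_comp_def mps_scale_mult mps_scale_of_nat_minus_1)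
qed (simp add: elem_sym_comp_def)

lemma weighted_elem_sym_Cons:
  "weighted_elem_sym (k # L) = of_nat k * elem_sym k * tail_term L"
  by (simp add: comp_weight_def elem_sym_comp_def mps_scale_mult mps_scale_of_nat
      flip: scale_elem_sym_comp_eq_tail_term)

lemma weighted_elem_sym_append:
  "K \<noteq> [] \<Longrightarrow> weighted_elem_sym (K @ L) = weighted_elem_sym K * tail_term L"
  by (cases K) (simp_all add: weighted_elem_sym_Cons mult.assoc)

lemma path_sym_eq_sum_weighted_elem_sym:
  assumes "1 \<le> n"
  shows "path_sym n = (\<Sum>I\<in>compositions n. weighted_elem_sym I)"
  using assms
proof (induction n rule: less_induct)
  case (less n)
  have "(\<Sum>L\<in>compositions (n - k). weighted_elem_sym (L @ [k])) =
      (of_nat k - 1) * elem_sym k * path_sym (n - k) + (if k = n then elem_sym n else 0)"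
    if "k \<in> {1..n}" for k
  proof (cases "k = n")
    case True
    then show ?thesis by (simp add: compositions_0 weighted_elem_sym_Cons algebra_simps)
  next
    case False
    then have k: "1 \<le> k" "1 \<le> n - k" "n - k < n" using that by auto
    have "(\<Sum>L\<in>compositions (n - k). weighted_elem_sym (L @ [k])) =
        (\<Sum>L\<in>compositions (n - k). (of_nat k - 1) * elem_sym k * weighted_elem_sym L)"
      using compositions_not_Nil[OF _ k(2)]
      by (intro sum.cong refl) (simp add: weighted_elem_sym_append mult.commute)
    also have "\<dots> = (of_nat k - 1) * elem_sym k * path_sym (n - k)"
      using less.IH[OF k(3,2)] by (simp add: sum_distrib_left)
    finally show ?thesis using False by simp
  qed
  then have "(\<Sum>I\<in>compositions n. weighted_elem_sym I) =
      (\<Sum>k=1..n. (of_nat k - 1) * elem_sym k * path_sym (n - k) + (if k = n then elem_sym n else 0))"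
    unfolding sum_compositions_snoc[OF less.prems] by (rule sum.cong[OF refl])
  also have "\<dots> = path_sym n"
    using less.prems by (simp add: sum.distrib path_sym_recurrence)
  finally show ?case by simp
qed

lemma path_sym_eq_sum_tail_sym:
  assumes "1 \<le> n"
  shows "path_sym n = (\<Sum>k=1..n. of_nat k * elem_sym k * tail_sym (n - k) :: rat mps)"
  unfolding path_sym_eq_sum_weighted_elem_sym[OF assms] sum_compositions_Cons[OF assms]
    weighted_elem_sym_Cons tail_sym_def sum_distrib_left ..

lemma tail_sym_recurrence:
  assumes "1 \<le> n"
  shows "tail_sym n = (\<Sum>k=1..n. (of_nat k - 1) * elem_sym k * tail_sym (n - k))"
  unfolding tail_sym_def sum_compositions_Cons[OF assms] tail_term_simps sum_distrib_left ..

text \<open>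
  The coefficients \<open>k\<close>, \<open>k - 1\<close> and \<open>max 0 (k - 2)\<close> of \<open>e\<^sub>k\<close> in the three sums have second
  difference \<open>1\<close> at \<open>k = 1\<close> and \<open>0\<close> for \<open>k \<ge> 2\<close>.
\<close>

lemma sum_last_reduced_tail_term:
  assumes "1 \<le> n"
  shows "(\<Sum>L\<in>compositions n. last_reduced_tail_term L) =
    2 * tail_sym n - path_sym n + (elem_sym 1 * tail_sym (n - 1) :: rat mps)"
proof -
  have "of_nat (k - 2) = 2 * (of_nat k - 1) - of_nat k + (if k = 1 then 1 else 0 :: rat mps)"
    if "1 \<le> k" for k
    using that by (cases "k = 1") (auto simp: of_nat_diff algebra_simps)
  then have "(\<Sum>L\<in>compositions n. last_reduced_tail_term L) =
      (\<Sum>k=1..n. (2 * (of_nat k - 1) - of_nat k + (if k = 1 then 1 else 0 :: rat mps)) *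
        elem_sym k * tail_sym (n - k))"
    unfolding sum_compositions_snoc[OF assms]
    by (simp add: last_reduced_tail_term_def tail_sym_def sum_distrib_left)
  also have "\<dots> = 2 * tail_sym n - path_sym n +
      (\<Sum>k=1..n. if k = 1 then elem_sym 1 * tail_sym (n - 1) else 0)"
    unfolding tail_sym_recurrence[OF assms] path_sym_eq_sum_tail_sym[OF assms]
      sum_distrib_left sum_subtractf[symmetric] sum.distrib[symmetric]
    by (intro sum.cong) (auto simp: algebra_simps)
  finally show ?thesis using assms by simp
qed


section \<open>Cutting a composition at a prescribed position\<close>

lemma sum_list_take_le: "sum_list (take k I) \<le> sum_list (I :: nat list)"
  by (metis append_take_drop_id le_add1 sum_list_append)

lemma sigma_plus_append:
  assumes "K \<noteq> []" "sum_list (butlast K) < c" "c \<le> sum_list K"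
  shows "sigma_plus (K @ L) c = sum_list K"
  unfolding sigma_plus_def
proof (rule Min_eqI)
  let ?S = "{sum_list (take k (K @ L)) | k. k \<le> length (K @ L) \<and> c \<le> sum_list (take k (K @ L))}"
  show "finite ?S" by simp
  show "sum_list K \<in> ?S" using assms(3) by (auto intro!: exI[of _ "length K"])
  fix s assume "s \<in> ?S"
  then obtain k where s: "s = sum_list (take k (K @ L))" "c \<le> s" by auto
  have "length K \<le> k"
  proof (rule ccontr)
    assume "\<not> length K \<le> k"
    then have "s = sum_list (take k (butlast K))" by (simp add: s(1) take_butlast)
    also have "\<dots> < c" using sum_list_take_le assms(2) by (rule le_less_trans)
    finally show False using s(2) by simp
  qed
  then show "sum_list K \<le> s" by (simp add: s(1))
qed

lemma ex_prefix_reaching: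
  fixes I :: "nat list"
  assumes "1 \<le> c" "c \<le> sum_list I"
  shows "\<exists>K L. I = K @ L \<and> K \<noteq> [] \<and> sum_list (butlast K) < c \<and> c \<le> sum_list K"
  using assms(2)
proof (induction I rule: rev_induct)
  case Nil
  then show ?case using assms(1) by simp
next
  case (snoc i I)
  show ?case
  proof (cases "c \<le> sum_list I")
    case True
    with snoc.IH show ?thesis by (metis append_assoc)
  next
    case False
    with snoc.prems show ?thesis by (intro exI[of _ "I @ [i]"] exI[of _ "[]"]) simp
  qed
qed

lemma append_eq_append_sum_list_eq:
  fixes K K' L L' :: "nat list"
  assumes "K @ L = K' @ L'" "sum_list K = sum_list K'" "\<forall>i\<in>set K \<union> set K'. 1 \<le> i"
  shows "K = K' \<and> L = L'"
proof -
  from assms(1) obtain U where U: "K = K' @ U \<and> U @ L = L' \<or> K @ U = K' \<and> L = U @ L'"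
    by (auto simp: append_eq_append_conv2)
  then have "sum_list U = 0" "\<forall>i\<in>set U. 1 \<le> i" using assms(2,3) by auto
  then have "U = []" by (cases U) auto
  with U show ?thesis by auto
qed

lemma inj_on_append_compositions: "inj_on (\<lambda>(K, L). K @ L) (compositions m \<times> B)"
proof (rule inj_onI, clarify)
  fix K L K' L'
  assume "K \<in> compositions m" "K' \<in> compositions m" and eq: "K @ L = K' @ L'"
  then have "sum_list K = sum_list K'" "\<forall>i\<in>set K \<union> set K'. 1 \<le> i"
    by (auto simp: compositions_def)
  with eq show "K = K' \<and> L = L'" by (rule append_eq_append_sum_list_eq)
qed

lemma bij_betw_append_compositions_Theta_plus:
  assumes "1 \<le> a" "a + t \<le> n"
  shows "bij_betw (\<lambda>(K, L). K @ L)
    ({K \<in> compositions (a + t). sum_list (butlast K) < a} \<times> compositions (n - (a + t)))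
    {I \<in> compositions n. Theta_plus I a = t}"
    (is "bij_betw _ (?A \<times> ?B) ?T")
  unfolding bij_betw_def
proof (intro conjI equalityI subsetI)
  show "inj_on (\<lambda>(K, L). K @ L) (?A \<times> ?B)"
    by (rule inj_on_subset[OF inj_on_append_compositions]) auto
next
  fix I assume "I \<in> (\<lambda>(K, L). K @ L) ` (?A \<times> ?B)"
  then obtain K L where I: "I = K @ L"
    and K: "K \<in> compositions (a + t)" "sum_list (butlast K) < a" and L: "L \<in> ?B"
    by auto
  have "K \<noteq> []" using assms(1) by (intro compositions_not_Nil[OF K(1)]) simp
  then have "sigma_plus (K @ L) a = sum_list K"
    using K by (intro sigma_plus_append) (auto simp: compositions_def)
  then show "I \<in> ?T"
    using I K(1) L assms(2) by (auto simp: compositions_def Theta_plus_def)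
next
  fix I assume "I \<in> ?T"
  then have I: "I \<in> compositions n" and Theta: "Theta_plus I a = t" by auto
  have "a \<le> sum_list I" using I assms(2) by (simp add: compositions_def)
  then obtain K L
    where KL: "I = K @ L" "K \<noteq> []" "sum_list (butlast K) < a" "a \<le> sum_list K"
    using ex_prefix_reaching assms(1) by blast
  then have "sum_list K = a + t"
    using Theta sigma_plus_append[OF KL(2-4)] by (simp add: Theta_plus_def)
  then have "K \<in> ?A" "L \<in> ?B" using I KL(1,3) by (auto simp: compositions_def)
  then show "I \<in> (\<lambda>(K, L). K @ L) ` (?A \<times> ?B)" using KL(1) by auto
qed

lemma sum_Theta_plus_eq:
  assumes "1 \<le> a" "a + t \<le> n"
  shows "(\<Sum>I | I \<in> compositions n \<and> Theta_plus I a = t. \<phi> I) =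
    (\<Sum>K | K \<in> compositions (a + t) \<and> sum_list (butlast K) < a.
      \<Sum>L\<in>compositions (n - (a + t)). \<phi> (K @ L))"
  using sum.reindex_bij_betw[OF bij_betw_append_compositions_Theta_plus[OF assms], of \<phi>]
  by (simp add: sum.cartesian_product case_prod_unfold)

lemma weighted_elem_sym_eq_0_if_overshoot:
  assumes K: "K \<in> compositions (a + t)" and "1 \<le> a" "t \<le> 1" "\<not> sum_list (butlast K) < a"
  shows "weighted_elem_sym K = 0"
proof -
  have "K \<noteq> []" using K assms(2) by (intro compositions_not_Nil[OF K]) simp
  then obtain M k where M: "K = M @ [k]" by (metis rev_exhaust)
  then have "a \<le> sum_list M" "sum_list M + k = a + t" "1 \<le> k"
    using K assms(4) by (auto simp: compositions_def)
  then have "M \<noteq> []" "k = 1" using assms(2,3) by auto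
  then show ?thesis by (simp add: M weighted_elem_sym_append)
qed

lemma sum_Theta_plus_eq_factor:
  assumes "1 \<le> a" "t \<le> 1" "a + t \<le> n"
    and factor: "\<And>K L. K \<noteq> [] \<Longrightarrow> L \<in> compositions (n - (a + t)) \<Longrightarrow>
      \<phi> (K @ L) = weighted_elem_sym K * \<psi> L"
  shows "(\<Sum>I | I \<in> compositions n \<and> Theta_plus I a = t. \<phi> I) =
    path_sym (a + t) * (\<Sum>L\<in>compositions (n - (a + t)). \<psi> L)"
proof -
  have not_Nil: "K \<noteq> []" if "K \<in> compositions (a + t)" for K
    using that assms(1) by (intro compositions_not_Nil[OF that]) simp
  have "(\<Sum>I | I \<in> compositions n \<and> Theta_plus I a = t. \<phi> I) =
      (\<Sum>K | K \<in> compositions (a + t) \<and> sum_list (butlast K) < a.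
        weighted_elem_sym K * (\<Sum>L\<in>compositions (n - (a + t)). \<psi> L))"
    unfolding sum_Theta_plus_eq[OF assms(1,3)] sum_distrib_left
    by (intro sum.cong refl factor) (auto simp: not_Nil)
  also have "\<dots> = (\<Sum>K\<in>compositions (a + t).
        weighted_elem_sym K * (\<Sum>L\<in>compositions (n - (a + t)). \<psi> L))"
    using weighted_elem_sym_eq_0_if_overshoot[OF _ assms(1,2)]
    by (intro sum.mono_neutral_left) (auto simp: finite_compositions)
  also have "\<dots> = path_sym (a + t) * (\<Sum>L\<in>compositions (n - (a + t)). \<psi> L)"
    using assms(1) by (simp add: path_sym_eq_sum_weighted_elem_sym sum_distrib_right)
  finally show ?thesis .
qed

lemma sum_Theta_plus_le_1_factor:
  assumes "1 \<le> a" "a + 1 \<le> n"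
    and factor: "\<And>K L. K \<noteq> [] \<Longrightarrow> L \<in> compositions (n - a) \<union> compositions (n - (a + 1)) \<Longrightarrow>
      \<phi> (K @ L) = weighted_elem_sym K * \<psi> L"
  shows "(\<Sum>I | I \<in> compositions n \<and> Theta_plus I a \<le> 1. \<phi> I) =
    path_sym a * (\<Sum>L\<in>compositions (n - a). \<psi> L) +
    path_sym (a + 1) * (\<Sum>L\<in>compositions (n - (a + 1)). \<psi> L)"
proof -
  let ?S = "\<lambda>t. {I \<in> compositions n. Theta_plus I a = t}"
  have "{I \<in> compositions n. Theta_plus I a \<le> 1} = ?S 0 \<union> ?S 1" by auto
  moreover have "sum \<phi> (?S 0 \<union> ?S 1) = sum \<phi> (?S 0) + sum \<phi> (?S 1)"
    by (rule sum.union_disjoint) (auto simp: finite_compositions)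
  ultimately show ?thesis
    using sum_Theta_plus_eq_factor[of a 0 n \<phi> \<psi>] sum_Theta_plus_eq_factor[of a 1 n \<phi> \<psi>] assms
    by simp
qed

lemma sum_weighted_elem_sym_Theta_plus_ge_2:
  assumes "1 \<le> a" "a + 1 \<le> n"
  shows "(\<Sum>I | I \<in> compositions n \<and> 2 \<le> Theta_plus I a. weighted_elem_sym I) =
    path_sym n - path_sym a * tail_sym (n - a) - path_sym (a + 1) * tail_sym (n - (a + 1))"
proof -
  let ?S = "{I \<in> compositions n. Theta_plus I a \<le> 1}"
  have "path_sym n = (\<Sum>I\<in>compositions n. weighted_elem_sym I)"
    using assms by (intro path_sym_eq_sum_weighted_elem_sym) simp
  also have "\<dots> = sum weighted_elem_sym (compositions n - ?S) + sum weighted_elem_sym ?S"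
    by (rule sum.subset_diff) (auto simp: finite_compositions)
  also have "compositions n - ?S = {I \<in> compositions n. 2 \<le> Theta_plus I a}" by auto
  also have "sum weighted_elem_sym ?S =
      path_sym a * tail_sym (n - a) + path_sym (a + 1) * tail_sym (n - (a + 1))"
    unfolding tail_sym_def using assms
    by (rule sum_Theta_plus_le_1_factor) (rule weighted_elem_sym_append)
  finally show ?thesis by (simp add: algebra_simps)
qed

abbreviation last_reduced_weighted_elem_sym :: "nat list \<Rightarrow> rat mps" where
  "last_reduced_weighted_elem_sym I \<equiv>
    ((of_nat (last I) - 2) / (of_nat (last I) - 1) * comp_weight I) *\<^sub>\<Lambda> elem_sym_comp I"

text \<open>If the last part is \<open>1\<close>, both sides vanish, the left one because \<open>x / 0 = 0\<close>.\<close>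

lemma last_reduced_weighted_elem_sym_append:
  assumes "K \<noteq> []" "L \<noteq> []" "1 \<le> last L"
  shows "last_reduced_weighted_elem_sym (K @ L) = weighted_elem_sym K * last_reduced_tail_term L"
proof -
  obtain M k where L: "L = M @ [k]" using assms(2) by (metis rev_exhaust)
  let ?r = "(of_nat k - 2) / (of_nat k - 1) :: rat"
  have "?r * (of_nat k - 1) = of_nat (k - 2)"
    using assms(3) by (cases "k = 1") (auto simp: L of_nat_diff)
  then have "?r * comp_weight (K @ L) = comp_weight (K @ M) * of_nat (k - 2)"
    using assms(1) by (cases K) (simp_all add: L comp_weight_def mult.assoc mult.left_commute)
  then have "(?r * comp_weight (K @ L)) *\<^sub>\<Lambda> elem_sym_comp (K @ L) =
      weighted_elem_sym (K @ M) * (of_nat (k - 2) * elem_sym k)"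
    by (simp only:) (simp add: L elem_sym_comp_def flip: mps_scale_mult mps_scale_of_nat mult.assoc)
  also have "\<dots> = weighted_elem_sym K * last_reduced_tail_term L"
    using assms(1) by (simp add: L last_reduced_tail_term_def weighted_elem_sym_append ac_simps)
  finally show ?thesis by (simp add: L)
qed

lemma sum_last_reduced_weighted_elem_sym_Theta_plus_le_1:
  assumes "1 \<le> a" "a + 2 \<le> n"
  shows "(\<Sum>I | I \<in> compositions n \<and> 3 \<le> last I \<and> Theta_plus I a \<le> 1.
      last_reduced_weighted_elem_sym I) =
    path_sym a * (\<Sum>L\<in>compositions (n - a). last_reduced_tail_term L) +
    path_sym (a + 1) * (\<Sum>L\<in>compositions (n - (a + 1)). last_reduced_tail_term L)"
    (is "sum ?\<phi> ?S = _")
proof -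
  have last_ge_1: "1 \<le> last I" if "I \<in> compositions m" "1 \<le> m" for I m
    using that compositions_not_Nil[OF that] by (auto simp: compositions_def)
  have "?\<phi> I = 0" if "I \<in> compositions n" "\<not> 3 \<le> last I" for I
  proof -
    have "last I = 1 \<or> last I = 2" using that last_ge_1[of I n] assms by auto
    then show ?thesis by auto
  qed
  then have "sum ?\<phi> ?S = (\<Sum>I | I \<in> compositions n \<and> Theta_plus I a \<le> 1. ?\<phi> I)"
    by (intro sum.mono_neutral_left) (auto simp: finite_compositions)
  also have "\<dots> = path_sym a * (\<Sum>L\<in>compositions (n - a). last_reduced_tail_term L) +
      path_sym (a + 1) * (\<Sum>L\<in>compositions (n - (a + 1)). last_reduced_tail_term L)"
  proof (rule sum_Theta_plus_le_1_factor)
    fix K L :: "nat list"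
    assume "K \<noteq> []" and "L \<in> compositions (n - a) \<union> compositions (n - (a + 1))"
    then obtain m where "L \<in> compositions m" "1 \<le> m" using assms by auto
    with \<open>K \<noteq> []\<close> show "?\<phi> (K @ L) = weighted_elem_sym K * last_reduced_tail_term L"
      using compositions_not_Nil[of L m] last_ge_1[of L m]
      by (intro last_reduced_weighted_elem_sym_append)
  qed (use assms in auto)
  finally show ?thesis .
qed

theorem theorem3p11:
  fixes a n :: nat
  assumes "1 \<le> a" and "a + 2 \<le> n"
  shows "(chromatic_sym {1..n} (bull_edges a n) :: rat mps) =
      (\<Sum>I | I \<in> compositions n \<and> 3 \<le> last I \<and> Theta_plus I a \<le> 1.
         ((of_nat (last I) - 2) / (of_nat (last I) - 1) * comp_weight I) *\<^sub>\<Lambda> elem_sym_comp I)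
    + (\<Sum>I | I \<in> compositions n \<and> 2 \<le> Theta_plus I a.
         (2 * comp_weight I) *\<^sub>\<Lambda> elem_sym_comp I)
    + (\<Sum>J | J \<in> compositions (n - 1) \<and> 2 \<le> Theta_plus J a.
         comp_weight J *\<^sub>\<Lambda> elem_sym_comp (J @ [1]))"
    (is "_ = ?A + ?B + ?C")
proof -
  let ?b = "n - a" and ?c = "n - (a + 1)" and ?d = "n - 1 - (a + 1)"
  have first_sum: "?A = path_sym a * (2 * tail_sym ?b - path_sym ?b + elem_sym 1 * tail_sym ?c) +
      path_sym (a + 1) * (2 * tail_sym ?c - path_sym ?c + elem_sym 1 * tail_sym ?d)"
    unfolding sum_last_reduced_weighted_elem_sym_Theta_plus_le_1[OF assms]
    using assms by (simp add: sum_last_reduced_tail_term)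
  have second_sum: "?B = 2 *
      (path_sym n - path_sym a * tail_sym ?b - path_sym (a + 1) * tail_sym ?c)"
    unfolding mps_scale_numeral_mult sum_distrib_left[symmetric]
    using assms by (simp add: sum_weighted_elem_sym_Theta_plus_ge_2)
  have third_sum: "?C = elem_sym 1 *
      (path_sym (n - 1) - path_sym a * tail_sym ?c - path_sym (a + 1) * tail_sym ?d)"
    unfolding scale_elem_sym_comp_snoc sum_distrib_left[symmetric]
    using assms by (simp add: sum_weighted_elem_sym_Theta_plus_ge_2)
  show ?thesis
    unfolding first_sum second_sum third_sum chromatic_sym_bull[OF assms]
    by (simp add: algebra_simps)
qed

end
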